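(* Let $f:\mathbb{R}\to\mathbb{R}$ be three times differentiable, let $R>0$ be a real number, let $N>0$ be an integer, and let $x_*\in\mathbb{R}$ satisfy $f'(x_* )=0$ and $f^{(2)}(x_* )>0$. Define functions $\bar g_N,\bar g_{N-1},\dots,\bar g_0$ (at every $x$ with $R+f^{(2)}(x)\neq 0$) by the backward recursion $$\bar g_N(x)=\frac{f'(x)}{R+f^{(2)}(x)},\qquad \bar g_{l}(x)=\frac{1}{R+f^{(2)}(x)}\bigl[f'(x)+R\,\bar g_{l+1}(x)\bigr],\quad l=N-1,\dots,0,$$ and consider the iteration $$x_{k+1}=x_k-\bar g_0(x_k),\qquad k=0,1,2,\dots.$$ Then the iteration is (locally) linearly convergent to $x_*$ with convergence constant $\left(\frac{R}{R+f^{(2)}(x_* )}\right)^{N+1}$. That is, for every $x_0\neq x_*$ sufficiently close to $x_*$, the sequence $(x_k)_{k\ge 0}$ is well defined, satisfies $x_k\neq x_*$ for all $k$, converges to $x_*$, and $$\lim_{k\to\infty}\frac{|x_{k+1}-x_*|}{|x_k-x_*|}=\left(\frac{R}{R+f^{(2)}(x_* )}\right)^{N+1}.$$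
   Context: Here $f^{(j)}$ denotes the $j$-th derivative of $f$. The underlying problem is to minimize $f$; $R$ is the (positive) control weight and $N$ the control terminal time of an associated optimal control problem, but only their values enter the iteration. *)

theory Defs
  imports "HOL-Analysis.Analysis"
begin

end

(*
  Summing the recursion as a geometric series gives
  g 0 y = f'(y) / f''(y) * (1 - (R / (R + f''(y)))^(N + 1)) wherever f''(y) \<noteq> 0 and R + f''(y) \<noteq> 0:
  each step is a damped Newton step.  As f'(y) / (y - xs) tends to f''(xs) and f'' is continuous, the error
  quotient of the iteration map tends to (R / (R + f''(xs)))^(N + 1), which lies strictly
  between 0 and 1.
*)
theory Submission
  imports Defs
begin

text \<open>Near \<open>p\<close> the error quotient stays below some \<open>r < 1\<close> in
  modulus, so \<open>T\<close> shrinks the distance to \<open>p\<close>, a punctured ball is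
  invariant and errors decay geometrically. \<open>P\<close> carries a condition that must hold
  along the orbit, such as well-definedness of the map.\<close>

lemma locally_linear_convergence:
  fixes T :: "real \<Rightarrow> real"
  assumes lim: "((\<lambda>y. (T y - p) / (y - p)) \<longlongrightarrow> c) (at p)"
    and c: "c \<noteq> 0" "\<bar>c\<bar> < 1"
    and P: "eventually P (at p)"
  shows "\<exists>\<delta>>0. \<forall>x :: nat \<Rightarrow> real.
           x 0 \<noteq> p \<and> \<bar>x 0 - p\<bar> < \<delta> \<and> (\<forall>k. x (k + 1) = T (x k)) \<longrightarrow>
             (\<forall>k. P (x k)) \<and> (\<forall>k. x k \<noteq> p) \<and> x \<longlonglongrightarrow> p \<and>
             (\<lambda>k. (x (k + 1) - p) / (x k - p)) \<longlonglongrightarrow> c"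
proof -
  \<comment> \<open>The midpoint of \<open>\<bar>c\<bar>\<close> and 1 leaves room on both
    sides.\<close>
  define r where "r = (1 + \<bar>c\<bar>) / 2"
  have r: "\<bar>c\<bar> < r" "0 < r" "r < 1"
    using c by (auto simp: r_def)
  \<comment> \<open>This is where \<open>c \<noteq> 0\<close> enters: a nonzero quotient forces
    \<open>T y \<noteq> p\<close>, so no iterate lands on \<open>p\<close>.\<close>
  have "\<forall>\<^sub>F y in at p. (T y - p) / (y - p) \<noteq> 0"
    using tendsto_imp_eventually_ne[OF lim c(1)] .
  moreover have "\<forall>\<^sub>F y in at p. \<bar>(T y - p) / (y - p)\<bar> < r"
    using order_tendstoD(2)[OF tendsto_rabs[OF lim] r(1)] .
  ultimately have "\<forall>\<^sub>F y in at p. P y \<and> (T y - p) / (y - p) \<noteq> 0 \<and> \<bar>(T y - p) / (y - p)\<bar> < r"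
    using P by eventually_elim auto
  then obtain \<delta> where "\<delta> > 0" and near: "\<And>y. y \<noteq> p \<Longrightarrow> \<bar>y - p\<bar> < \<delta> \<Longrightarrow>
      P y \<and> (T y - p) / (y - p) \<noteq> 0 \<and> \<bar>(T y - p) / (y - p)\<bar> < r"
    unfolding eventually_at dist_real_def by auto
  have "(\<forall>k. P (x k)) \<and> (\<forall>k. x k \<noteq> p) \<and> x \<longlonglongrightarrow> p \<and>
      (\<lambda>k. (x (k + 1) - p) / (x k - p)) \<longlonglongrightarrow> c"
    if x0: "x 0 \<noteq> p" "\<bar>x 0 - p\<bar> < \<delta>" and step: "\<And>k. x (k + 1) = T (x k)" for x :: "nat \<Rightarrow> real"
  proof -
    have inv: "x k \<noteq> p \<and> \<bar>x k - p\<bar> < \<delta> \<and> \<bar>x k - p\<bar> \<le> r ^ k * \<bar>x 0 - p\<bar>" for k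
    proof (induction k)
      case 0
      then show ?case using x0 by simp
    next
      case (Suc k)
      then have ne: "x k \<noteq> p" and quot: "(T (x k) - p) / (x k - p) \<noteq> 0"
          "\<bar>(T (x k) - p) / (x k - p)\<bar> < r"
        using near by auto
      have contr: "\<bar>T (x k) - p\<bar> \<le> r * \<bar>x k - p\<bar>"
        using quot(2) ne by (simp add: abs_divide field_simps)
      also have "\<dots> \<le> r * (r ^ k * \<bar>x 0 - p\<bar>)"
        using Suc r by (intro mult_left_mono) auto
      finally have "\<bar>T (x k) - p\<bar> \<le> r ^ Suc k * \<bar>x 0 - p\<bar>"
        by (simp add: mult.assoc)
      moreover have "r * \<bar>x k - p\<bar> \<le> 1 * \<bar>x k - p\<bar>"
        using r by (intro mult_right_mono) auto
      then have "\<bar>T (x k) - p\<bar> < \<delta>"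
        using contr Suc.IH by (metis mult_1 order.strict_trans1)
      moreover have "T (x k) \<noteq> p" using quot(1) by auto
      ultimately show ?case using step[of k] by simp
    qed
    have "(\<lambda>k. r ^ k * \<bar>x 0 - p\<bar>) \<longlonglongrightarrow> 0"
      using r by (intro tendsto_mult_left_zero LIMSEQ_realpow_zero) auto
    then have "(\<lambda>k. x k - p) \<longlonglongrightarrow> 0"
      by (rule Lim_null_comparison[rotated]) (use inv in auto)
    then have conv: "x \<longlonglongrightarrow> p"
      by (simp add: LIM_zero_iff)
    \<comment> \<open>The limit \<open>lim\<close> lives on the punctured filter
      \<open>at p\<close>; composing with it needs \<open>x k \<noteq> p\<close> besides
      convergence.\<close>
    then have "filterlim x (at p) sequentially"
      using inv by (auto simp: filterlim_at)
    from filterlim_compose[OF lim this] have "(\<lambda>k. (x (k + 1) - p) / (x k - p)) \<longlonglongrightarrow> c"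
      by (simp only: step)
    then show ?thesis using conv inv near by auto
  qed
  with \<open>\<delta> > 0\<close> show ?thesis by blast
qed

text \<open>With the point frozen, one step is the affine map u \<mapsto> (a + R u) / (R + h). Its
  fixed point is a / h, and each step multiplies the deviation from it by R / (R + h). The value at
  \<open>N\<close> is itself one step from u = 0, hence the extra 1 in the exponent.\<close>

lemma backward_recursion_closed_form:
  fixes a h R :: "'a::field" and g :: "nat \<Rightarrow> 'a"
  assumes h: "h \<noteq> 0" "R + h \<noteq> 0"
    and g_N: "g N = a / (R + h)"
    and g_rec: "\<And>l. l < N \<Longrightarrow> g l = 1 / (R + h) * (a + R * g (l + 1))"
    and "l \<le> N"
  shows "g l = a / h * (1 - (R / (R + h)) ^ (N - l + 1))"
  using \<open>l \<le> N\<close>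
proof (induction l rule: inc_induct)
  case base
  then show ?case using h by (simp add: g_N field_simps)
next
  case (step l)
  \<comment> \<open>\<open>q\<close> is the power belonging to index \<open>l + 1\<close>: as
    \<open>l < N\<close>, the truncated difference satisfies
    \<open>N - Suc l + 1 = N - l\<close>.\<close>
  define q where "q = (R / (R + h)) ^ (N - l)"
  have "g (l + 1) = a / h * (1 - q)"
  proof -
    have "N - Suc l + 1 = N - l" using step by simp
    with step.IH show ?thesis by (simp only: q_def Suc_eq_plus1)
  qed
  then have "g l = 1 / (R + h) * (a + R * (a / h * (1 - q)))"
    by (simp only: g_rec[OF step.hyps(2)])
  also have "\<dots> = a / h * (1 - R / (R + h) * q)"
    using h by (simp add: field_simps)
  finally show ?case by (simp add: q_def)
qed

theorem theorem1:
  fixes f :: "real \<Rightarrow> real" and R xs :: real and N :: nat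
    and g :: "nat \<Rightarrow> real \<Rightarrow> real"
  assumes f_diff: "\<And>j y. j < 3 \<Longrightarrow> (deriv ^^ j) f field_differentiable at y"
    and R_pos: "R > 0"
    and N_pos: "N > 0"
    and crit: "(deriv ^^ 1) f xs = 0"
    and second: "(deriv ^^ 2) f xs > 0"
    and g_N: "\<And>y. R + (deriv ^^ 2) f y \<noteq> 0 \<Longrightarrow>
                g N y = (deriv ^^ 1) f y / (R + (deriv ^^ 2) f y)"
    and g_rec: "\<And>l y. l < N \<Longrightarrow> R + (deriv ^^ 2) f y \<noteq> 0 \<Longrightarrow>
                g l y = 1 / (R + (deriv ^^ 2) f y) * ((deriv ^^ 1) f y + R * g (l + 1) y)"
  shows "\<exists>\<delta>>0. \<forall>x :: nat \<Rightarrow> real.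
           x 0 \<noteq> xs \<and> \<bar>x 0 - xs\<bar> < \<delta> \<and> (\<forall>k. x (k + 1) = x k - g 0 (x k)) \<longrightarrow>
             (\<forall>k. R + (deriv ^^ 2) f (x k) \<noteq> 0) \<and>
             (\<forall>k. x k \<noteq> xs) \<and>
             x \<longlonglongrightarrow> xs \<and>
             (\<lambda>k. \<bar>x (k + 1) - xs\<bar> / \<bar>x k - xs\<bar>)
               \<longlonglongrightarrow> (R / (R + (deriv ^^ 2) f xs)) ^ (N + 1)"
proof -
  define f1 f2 where "f1 = (deriv ^^ 1) f" and "f2 = (deriv ^^ 2) f"
  have "f2 = deriv f1" by (simp add: f1_def f2_def numeral_2_eq_2)
  then have "(f1 has_field_derivative f2 xs) (at xs)"
    using f_diff[of 1 xs] by (simp add: f1_def DERIV_deriv_iff_field_differentiable)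
  \<comment> \<open>Since f' vanishes at \<open>xs\<close>, this is the difference quotient of f'
    there.\<close>
  then have quot: "((\<lambda>y. f1 y / (y - xs)) \<longlongrightarrow> f2 xs) (at xs)"
    using crit by (simp add: has_field_derivative_iff f1_def)
  \<comment> \<open>The third derivative serves to make f'' continuous at \<open>xs\<close>.\<close>
  have "f2 field_differentiable at xs" using f_diff[of 2 xs] by (simp add: f2_def)
  then have f2_lim: "(f2 \<longlongrightarrow> f2 xs) (at xs)"
    using field_differentiable_imp_continuous_at isContD by blast
  have pos: "f2 xs > 0" using second by (simp add: f2_def)
  define c where "c = (R / (R + f2 xs)) ^ (N + 1)"
  have q: "0 < R / (R + f2 xs)" "R / (R + f2 xs) < 1"
    using R_pos pos by auto
  have c: "0 < c" "c < 1"
    using zero_less_power[OF q(1), of "N + 1"] power_Suc_less_one[OF q, of N] by (simp_all only: c_def Suc_eq_plus1)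
  have f2_ev: "\<forall>\<^sub>F y in at xs. f2 y > 0"
    using order_tendstoD(1)[OF f2_lim pos] .
  have "((\<lambda>y. 1 - f1 y / (y - xs) / f2 y * (1 - (R / (R + f2 y)) ^ (N + 1))) \<longlongrightarrow>
        1 - f2 xs / f2 xs * (1 - c)) (at xs)"
    unfolding c_def using R_pos pos by (intro tendsto_intros quot f2_lim) auto
  then have "((\<lambda>y. 1 - f1 y / (y - xs) / f2 y * (1 - (R / (R + f2 y)) ^ (N + 1))) \<longlongrightarrow> c) (at xs)"
    using pos by simp
  \<comment> \<open>Positivity of \<open>f2 y\<close> makes both denominators of the closed form
    nonzero, and \<open>y \<noteq> xs\<close> permits dividing by the error.\<close>
  moreover have "\<forall>\<^sub>F y in at xs. 1 - f1 y / (y - xs) / f2 y * (1 - (R / (R + f2 y)) ^ (N + 1))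
      = (y - g 0 y - xs) / (y - xs)"
    using f2_ev eventually_neq_at_within[of xs]
  proof eventually_elim
    case (elim y)
    have "g 0 y = f1 y / f2 y * (1 - (R / (R + f2 y)) ^ (N - 0 + 1))"
      using elim R_pos g_N[of y] g_rec[of _ y]
      by (intro backward_recursion_closed_form[where g = "\<lambda>l. g l y"]) (auto simp: f1_def f2_def)
    moreover have "(y - g 0 y - xs) / (y - xs) = 1 - g 0 y / (y - xs)"
      using elim by (simp add: field_simps)
    ultimately show ?case by simp
  qed
  ultimately have lim: "((\<lambda>y. (y - g 0 y - xs) / (y - xs)) \<longlongrightarrow> c) (at xs)"
    by (rule Lim_transform_eventually)
  have "\<forall>\<^sub>F y in at xs. R + f2 y \<noteq> 0"
    using f2_ev by eventually_elim (use R_pos in auto)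
  from locally_linear_convergence[OF lim _ _ this] c
  obtain \<delta> where "\<delta> > 0" and \<delta>: "\<And>x :: nat \<Rightarrow> real.
      x 0 \<noteq> xs \<and> \<bar>x 0 - xs\<bar> < \<delta> \<and> (\<forall>k. x (k + 1) = x k - g 0 (x k)) \<Longrightarrow>
        (\<forall>k. R + f2 (x k) \<noteq> 0) \<and> (\<forall>k. x k \<noteq> xs) \<and> x \<longlonglongrightarrow> xs \<and>
        (\<lambda>k. (x (k + 1) - xs) / (x k - xs)) \<longlonglongrightarrow> c"
    by auto
  \<comment> \<open>The signed quotients already converge; \<open>c > 0\<close> makes the limit of
    their absolute values \<open>c\<close> again.\<close>
  have "(\<lambda>k. \<bar>x (k + 1) - xs\<bar> / \<bar>x k - xs\<bar>) \<longlonglongrightarrow> c"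
    if "(\<lambda>k. (x (k + 1) - xs) / (x k - xs)) \<longlonglongrightarrow> c" for x :: "nat \<Rightarrow> real"
    using tendsto_rabs[OF that] c by (simp add: abs_divide)
  with \<delta> \<open>\<delta> > 0\<close> show ?thesis
    unfolding c_def f2_def by blast
qed

end
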